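(* Let $\varphi$ be a monadic second-order formula with one unary function symbol. Then the spectrum of $\varphi$ is eventually periodic; that is, writing $S\subseteq\mathbb{N}$ for the set of cardinalities of finite models of $\varphi$, there exist natural numbers $\theta$ and $p>0$ such that for every $n\ge\theta$, if $n\in S$ then $n+p\in S$.
   Context: Monadic second-order logic (MSO) extends first-order logic by quantification over subsets of the universe (set variables, with membership of elements in sets). An MSO formula with one unary function symbol is an MSO formula in a finite vocabulary such that (i) all predicate symbols, with the exception of equality, are unary, and (ii) there is only one function symbol, and it is unary (there are no constant symbols). Formulas whose models are considered are closed (sentences). The spectrum of a formula is the set of the cardinalities of its finite models. A set $S$ of natural numbers is eventually periodic if there exist natural numbers $\theta$ and $p>0$ such that for every $n\ge\theta$, if $S$ contains $n$ then it contains $n+p$. *)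

theory Defs
  imports Main
begin

section \<open>Monadic second-order logic with one unary function symbol\<close>

text \<open>
  The function symbol is the constructor \<open>Fn\<close>; the unary predicate symbols are elements
  of \<open>'p\<close>. First-order variables and set variables are two separate sorts, both named by
  natural numbers.
\<close>

datatype trm = Var nat | Fn trm

datatype 'p mso =
    Eq trm trm
  | Pred 'p trm
  | Mem trm nat
  | Neg "'p mso"
  | Conj "'p mso" "'p mso"
  | Disj "'p mso" "'p mso"
  | Imp "'p mso" "'p mso"
  | Ex nat "'p mso"
  | All nat "'p mso"
  | ExS nat "'p mso"
  | AllS nat "'p mso"

primrec trm_var :: "trm \<Rightarrow> nat" where
  "trm_var (Var x) = x"
| "trm_var (Fn t) = trm_var t"

primrec preds :: "'p mso \<Rightarrow> 'p set" where
  "preds (Eq s t) = {}"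
| "preds (Pred p t) = {p}"
| "preds (Mem t X) = {}"
| "preds (Neg \<phi>) = preds \<phi>"
| "preds (Conj \<phi> \<psi>) = preds \<phi> \<union> preds \<psi>"
| "preds (Disj \<phi> \<psi>) = preds \<phi> \<union> preds \<psi>"
| "preds (Imp \<phi> \<psi>) = preds \<phi> \<union> preds \<psi>"
| "preds (Ex x \<phi>) = preds \<phi>"
| "preds (All x \<phi>) = preds \<phi>"
| "preds (ExS X \<phi>) = preds \<phi>"
| "preds (AllS X \<phi>) = preds \<phi>"

primrec free_vars :: "'p mso \<Rightarrow> nat set" where
  "free_vars (Eq s t) = {trm_var s, trm_var t}"
| "free_vars (Pred p t) = {trm_var t}"
| "free_vars (Mem t X) = {trm_var t}"
| "free_vars (Neg \<phi>) = free_vars \<phi>"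
| "free_vars (Conj \<phi> \<psi>) = free_vars \<phi> \<union> free_vars \<psi>"
| "free_vars (Disj \<phi> \<psi>) = free_vars \<phi> \<union> free_vars \<psi>"
| "free_vars (Imp \<phi> \<psi>) = free_vars \<phi> \<union> free_vars \<psi>"
| "free_vars (Ex x \<phi>) = free_vars \<phi> - {x}"
| "free_vars (All x \<phi>) = free_vars \<phi> - {x}"
| "free_vars (ExS X \<phi>) = free_vars \<phi>"
| "free_vars (AllS X \<phi>) = free_vars \<phi>"

primrec free_set_vars :: "'p mso \<Rightarrow> nat set" where
  "free_set_vars (Eq s t) = {}"
| "free_set_vars (Pred p t) = {}"
| "free_set_vars (Mem t X) = {X}"
| "free_set_vars (Neg \<phi>) = free_set_vars \<phi>"
| "free_set_vars (Conj \<phi> \<psi>) = free_set_vars \<phi> \<union> free_set_vars \<psi>"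
| "free_set_vars (Disj \<phi> \<psi>) = free_set_vars \<phi> \<union> free_set_vars \<psi>"
| "free_set_vars (Imp \<phi> \<psi>) = free_set_vars \<phi> \<union> free_set_vars \<psi>"
| "free_set_vars (Ex x \<phi>) = free_set_vars \<phi>"
| "free_set_vars (All x \<phi>) = free_set_vars \<phi>"
| "free_set_vars (ExS X \<phi>) = free_set_vars \<phi> - {X}"
| "free_set_vars (AllS X \<phi>) = free_set_vars \<phi> - {X}"

definition closed_mso :: "'p mso \<Rightarrow> bool" where
  "closed_mso \<phi> \<longleftrightarrow> free_vars \<phi> = {} \<and> free_set_vars \<phi> = {}"

section \<open>Structures and satisfaction\<close>

record ('p, 'a) mstruct =
  universe :: "'a set"
  func :: "'a \<Rightarrow> 'a"
  prd :: "'p \<Rightarrow> 'a set"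

text \<open>
  A structure for the vocabulary consisting of the function symbol and the predicate symbols
  in \<open>V\<close>. Universes are nonempty, as usual. The values of \<open>func\<close> outside the
  universe and of \<open>prd\<close> outside \<open>V\<close> carry no information.
\<close>

definition is_struct :: "'p set \<Rightarrow> ('p, 'a) mstruct \<Rightarrow> bool" where
  "is_struct V M \<longleftrightarrow>
     universe M \<noteq> {} \<and> (\<forall>a\<in>universe M. func M a \<in> universe M) \<and> (\<forall>p\<in>V. prd M p \<subseteq> universe M)"

primrec trm_val :: "('p, 'a) mstruct \<Rightarrow> (nat \<Rightarrow> 'a) \<Rightarrow> trm \<Rightarrow> 'a" where
  "trm_val M v (Var x) = v x"
| "trm_val M v (Fn t) = func M (trm_val M v t)"

primrec sat :: "('p, 'a) mstruct \<Rightarrow> (nat \<Rightarrow> 'a) \<Rightarrow> (nat \<Rightarrow> 'a set) \<Rightarrow> 'p mso \<Rightarrow> bool" where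
  "sat M v W (Eq s t) \<longleftrightarrow> trm_val M v s = trm_val M v t"
| "sat M v W (Pred p t) \<longleftrightarrow> trm_val M v t \<in> prd M p"
| "sat M v W (Mem t X) \<longleftrightarrow> trm_val M v t \<in> W X"
| "sat M v W (Neg \<phi>) \<longleftrightarrow> \<not> sat M v W \<phi>"
| "sat M v W (Conj \<phi> \<psi>) \<longleftrightarrow> sat M v W \<phi> \<and> sat M v W \<psi>"
| "sat M v W (Disj \<phi> \<psi>) \<longleftrightarrow> sat M v W \<phi> \<or> sat M v W \<psi>"
| "sat M v W (Imp \<phi> \<psi>) \<longleftrightarrow> (sat M v W \<phi> \<longrightarrow> sat M v W \<psi>)"
| "sat M v W (Ex x \<phi>) \<longleftrightarrow> (\<exists>a\<in>universe M. sat M (v(x := a)) W \<phi>)"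
| "sat M v W (All x \<phi>) \<longleftrightarrow> (\<forall>a\<in>universe M. sat M (v(x := a)) W \<phi>)"
| "sat M v W (ExS X \<phi>) \<longleftrightarrow> (\<exists>A. A \<subseteq> universe M \<and> sat M v (W(X := A)) \<phi>)"
| "sat M v W (AllS X \<phi>) \<longleftrightarrow> (\<forall>A. A \<subseteq> universe M \<longrightarrow> sat M v (W(X := A)) \<phi>)"

text \<open>
  For closed formulas the valuation is irrelevant; since universes are nonempty, the
  quantification over valuations is not vacuous.
\<close>

definition models :: "('p, 'a) mstruct \<Rightarrow> 'p mso \<Rightarrow> bool" where
  "models M \<phi> \<longleftrightarrow>
     (\<forall>v W. (\<forall>x. v x \<in> universe M) \<and> (\<forall>X. W X \<subseteq> universe M) \<longrightarrow> sat M v W \<phi>)"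

section \<open>Spectra\<close>

text \<open>
  The definition lets universes range over finite sets of natural numbers only; by
  isomorphism invariance (\<open>card_in_spectrum\<close> below) finite models over any type
  contribute no further cardinalities.
\<close>

definition spectrum :: "'p set \<Rightarrow> 'p mso \<Rightarrow> nat set" where
  "spectrum V \<phi> =
     {card (universe M) | M :: ('p, nat) mstruct. is_struct V M \<and> finite (universe M) \<and> models M \<phi>}"

definition eventually_periodic :: "nat set \<Rightarrow> bool" where
  "eventually_periodic S \<longleftrightarrow> (\<exists>\<theta> p. p > 0 \<and> (\<forall>n\<ge>\<theta>. n \<in> S \<longrightarrow> n + p \<in> S))"

section \<open>Basic facts\<close>

lemma trm_val_cong: "v (trm_var t) = v' (trm_var t) \<Longrightarrow> trm_val M v t = trm_val M v' t"
  by (induction t) auto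

lemma sat_cong:
  assumes "\<And>x. x \<in> free_vars \<phi> \<Longrightarrow> v x = v' x"
    and "\<And>X. X \<in> free_set_vars \<phi> \<Longrightarrow> W X = W' X"
  shows "sat M v W \<phi> \<longleftrightarrow> sat M v' W' \<phi>"
  using assms
proof (induction \<phi> arbitrary: v v' W W')
  case (Eq s t)
  then show ?case using trm_val_cong[of v s v' M] trm_val_cong[of v t v' M] by simp
next
  case (Pred p t)
  then show ?case using trm_val_cong[of v t v' M] by simp
next
  case (Mem t X)
  then show ?case using trm_val_cong[of v t v' M] by simp
next
  case (Neg \<phi>)
  show ?case using Neg.IH[of v v' W W'] Neg.prems by simp
next
  case (Conj \<phi> \<psi>)
  show ?case using Conj.IH(1)[of v v' W W'] Conj.IH(2)[of v v' W W'] Conj.prems by simp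
next
  case (Disj \<phi> \<psi>)
  show ?case using Disj.IH(1)[of v v' W W'] Disj.IH(2)[of v v' W W'] Disj.prems by simp
next
  case (Imp \<phi> \<psi>)
  show ?case using Imp.IH(1)[of v v' W W'] Imp.IH(2)[of v v' W W'] Imp.prems by simp
next
  case (Ex x \<phi>)
  have "sat M (v(x := a)) W \<phi> \<longleftrightarrow> sat M (v'(x := a)) W' \<phi>" for a
    using Ex.prems by (intro Ex.IH) auto
  then show ?case by simp
next
  case (All x \<phi>)
  have "sat M (v(x := a)) W \<phi> \<longleftrightarrow> sat M (v'(x := a)) W' \<phi>" for a
    using All.prems by (intro All.IH) auto
  then show ?case by simp
next
  case (ExS X \<phi>)
  have "sat M v (W(X := A)) \<phi> \<longleftrightarrow> sat M v' (W'(X := A)) \<phi>" for A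
    using ExS.prems by (intro ExS.IH) auto
  then show ?case by simp
next
  case (AllS X \<phi>)
  have "sat M v (W(X := A)) \<phi> \<longleftrightarrow> sat M v' (W'(X := A)) \<phi>" for A
    using AllS.prems by (intro AllS.IH) auto
  then show ?case by simp
qed

lemma models_closed_iff:
  assumes "closed_mso \<phi>" "universe M \<noteq> {}"
  shows "models M \<phi> \<longleftrightarrow> sat M v W \<phi>"
proof -
  obtain a where a: "a \<in> universe M" using assms(2) by blast
  have "sat M v' W' \<phi> \<longleftrightarrow> sat M v W \<phi>" for v' W'
    using assms(1) by (intro sat_cong) (auto simp: closed_mso_def)
  then show ?thesis
    unfolding models_def using a by (auto dest: spec[of _ "\<lambda>_. a"] spec[of _ "\<lambda>_. {}"])
qed

lemma trm_val_iso:
  assumes "\<And>a. a \<in> universe M \<Longrightarrow> func M a \<in> universe M \<and> h (func M a) = func N (h a)"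
    and "\<And>x. v x \<in> universe M"
  shows "trm_val M v t \<in> universe M \<and> trm_val N (h \<circ> v) t = h (trm_val M v t)"
  using assms by (induction t) auto

lemma sat_iso:
  assumes bij: "bij_betw h (universe M) (universe N)"
    and func: "\<And>a. a \<in> universe M \<Longrightarrow> func M a \<in> universe M \<and> h (func M a) = func N (h a)"
    and prd: "\<And>p a. p \<in> preds \<phi> \<Longrightarrow> a \<in> universe M \<Longrightarrow> a \<in> prd M p \<longleftrightarrow> h a \<in> prd N p"
    and v: "\<And>x. v x \<in> universe M" and W: "\<And>X. W X \<subseteq> universe M"
  shows "sat M v W \<phi> \<longleftrightarrow> sat N (h \<circ> v) (\<lambda>X. h ` W X) \<phi>"
proof -
  have inj: "inj_on h (universe M)" and im: "universe N = h ` universe M"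
    using bij by (auto simp: bij_betw_def)
  have upd: "h \<circ> v(x := a) = (h \<circ> v)(x := h a)" for v and x :: nat and a
    by auto
  have updS: "(\<lambda>Y. h ` (W(X := A)) Y) = (\<lambda>Y. h ` W Y)(X := h ` A)" for W and X :: nat and A
    by (simp add: fun_eq_iff)
  have ball: "(\<forall>b\<in>universe N. P b) \<longleftrightarrow> (\<forall>a\<in>universe M. P (h a))" for P
    using im by simp
  have ballS: "(\<forall>B. B \<subseteq> universe N \<longrightarrow> P B) \<longleftrightarrow> (\<forall>A. A \<subseteq> universe M \<longrightarrow> P (h ` A))" for P
    unfolding im by (metis image_mono subset_imageE)
  note tv = trm_val_iso[of M h N, OF func]
  show ?thesis
    using prd v W
  proof (induction \<phi> arbitrary: v W)
    case (Eq s t)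
    then show ?case using tv[of v s] tv[of v t] inj by (simp add: inj_on_eq_iff comp_def)
  next
    case (Pred p t)
    then show ?case using tv[of v t] by (simp add: comp_def)
  next
    case (Mem t X)
    then show ?case using tv[of v t] inj by (simp add: inj_on_image_mem_iff comp_def)
  next
    case (Neg \<phi>)
    show ?case using Neg.IH[of v W] Neg.prems by simp
  next
    case (Conj \<phi> \<psi>)
    show ?case using Conj.IH(1)[of v W] Conj.IH(2)[of v W] Conj.prems by simp
  next
    case (Disj \<phi> \<psi>)
    show ?case using Disj.IH(1)[of v W] Disj.IH(2)[of v W] Disj.prems by simp
  next
    case (Imp \<phi> \<psi>)
    show ?case using Imp.IH(1)[of v W] Imp.IH(2)[of v W] Imp.prems by simp
  next
    case (Ex x \<phi>)
    have "sat M (v(x := a)) W \<phi> \<longleftrightarrow> sat N ((h \<circ> v)(x := h a)) (\<lambda>X. h ` W X) \<phi>"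
      if "a \<in> universe M" for a
      unfolding upd[symmetric] using Ex.prems that by (intro Ex.IH) auto
    then show ?case using im by (simp add: comp_def)
  next
    case (All x \<phi>)
    have "sat M (v(x := a)) W \<phi> \<longleftrightarrow> sat N ((h \<circ> v)(x := h a)) (\<lambda>X. h ` W X) \<phi>"
      if "a \<in> universe M" for a
      unfolding upd[symmetric] using All.prems that by (intro All.IH) auto
    then show ?case by (simp add: ball comp_def)
  next
    case (ExS X \<phi>)
    have "sat M v (W(X := A)) \<phi> \<longleftrightarrow> sat N (h \<circ> v) ((\<lambda>X. h ` W X)(X := h ` A)) \<phi>"
      if "A \<subseteq> universe M" for A
      unfolding updS[symmetric] using ExS.prems that by (intro ExS.IH) auto
    then show ?case
      using ballS[of "\<lambda>B. \<not> sat N (h \<circ> v) ((\<lambda>X. h ` W X)(X := B)) \<phi>"] by (auto simp: comp_def)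
  next
    case (AllS X \<phi>)
    have "sat M v (W(X := A)) \<phi> \<longleftrightarrow> sat N (h \<circ> v) ((\<lambda>X. h ` W X)(X := h ` A)) \<phi>"
      if "A \<subseteq> universe M" for A
      unfolding updS[symmetric] using AllS.prems that by (intro AllS.IH) auto
    then show ?case by (simp add: ballS comp_def)
  qed
qed

lemma card_in_spectrum:
  fixes M :: "('p, 'a) mstruct"
  assumes "is_struct V M" "finite (universe M)" "models M \<phi>"
  shows "card (universe M) \<in> spectrum V \<phi>"
proof -
  obtain h where h: "bij_betw h (universe M) {0..<card (universe M)}"
    using ex_bij_betw_finite_nat[OF assms(2)] by blast
  define g where "g = inv_into (universe M) h"
  define N :: "('p, nat) mstruct" where
    "N = \<lparr>universe = {0..<card (universe M)}, func = (\<lambda>b. h (func M (g b))),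
          prd = (\<lambda>p. h ` (prd M p \<inter> universe M))\<rparr>"
  have uN: "universe N = {0..<card (universe M)}" and hN: "bij_betw h (universe M) (universe N)"
    using h by (simp_all add: N_def)
  have inj: "inj_on h (universe M)" and im: "h ` universe M = universe N"
    using hN by (auto simp: bij_betw_def)
  have gh: "g (h a) = a" if "a \<in> universe M" for a
    using inj that by (simp add: g_def)
  have hg: "h (g b) = b" and g: "g b \<in> universe M" if "b \<in> universe N" for b
    using that im by (auto simp: g_def f_inv_into_f inv_into_into)
  have fM: "func M a \<in> universe M" if "a \<in> universe M" for a
    using assms(1) that by (simp add: is_struct_def)
  have hu: "h a \<in> universe N" if "a \<in> universe M" for a
    using im that by blast
  have "universe N \<noteq> {}"
    using assms(1) im by (auto simp: is_struct_def)
  moreover have "func N b \<in> universe N" if "b \<in> universe N" for b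
    using hu[OF fM[OF g[OF that]]] by (simp add: N_def)
  moreover have "prd N p \<subseteq> universe N" for p
    using im by (auto simp: N_def)
  ultimately have sN: "is_struct V N"
    by (simp add: is_struct_def)
  have "models N \<phi>"
    unfolding models_def
  proof (intro allI impI)
    fix v :: "nat \<Rightarrow> nat" and W :: "nat \<Rightarrow> nat set"
    assume *: "(\<forall>x. v x \<in> universe N) \<and> (\<forall>X. W X \<subseteq> universe N)"
    have gv: "(g \<circ> v) x \<in> universe M" for x
      using * g by simp
    have gW: "g ` W X \<subseteq> universe M" for X
      using * g by blast
    have prd: "a \<in> prd M p \<longleftrightarrow> h a \<in> prd N p" if "a \<in> universe M" for a p
      using inj that by (auto simp: N_def dest: inj_onD)
    have func: "func M a \<in> universe M \<and> h (func M a) = func N (h a)" if "a \<in> universe M" for a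
      using that fM gh by (simp add: N_def)
    have "h \<circ> (g \<circ> v) = v"
      using * hg by (auto simp: fun_eq_iff)
    moreover have "(\<lambda>X. h ` (g ` W X)) = W"
    proof
      fix X
      have "(h \<circ> g) ` W X = id ` W X"
        using * hg by (intro image_cong) auto
      then show "h ` (g ` W X) = W X" by (simp add: image_comp)
    qed
    moreover have "sat M (g \<circ> v) (\<lambda>X. g ` W X) \<phi>"
      using assms(3) gv gW by (simp add: models_def)
    ultimately show "sat N v W \<phi>"
      using sat_iso[of h M N \<phi> "g \<circ> v" "\<lambda>X. g ` W X", OF hN func prd gv gW] by simp
  qed
  then show ?thesis
    using sN uN unfolding spectrum_def by (auto intro!: exI[of _ N])
qed

end

theory Submission
  imports Defs
begin

text \<open>
  A finite structure with one unary function has bounded clique-width: it is described by a binary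
  tree whose leaves are the elements of the structure and whose inner nodes say how two smaller
  graphs are glued together. The satisfaction of a monadic second-order formula is determined by a
  finite invariant of the tree that can be computed from the leaves upwards, as by a tree automaton.
  A branch of a large tree therefore repeats a value of the invariant, and repeating the part of the
  tree in between adds leaves without affecting the formula. For each value \<open>q\<close> of the invariant
  that can be repeated fix one number \<open>d q\<close> of leaves gained in this way; the period is the product
  of these numbers.
\<close>

section \<open>Pumping in trees\<close>

datatype glue = Attach | Adjoin

datatype 'l tree = Leaf 'l | Node glue "'l tree" "'l tree"

primrec leaves :: "'l tree \<Rightarrow> nat" where
  "leaves (Leaf l) = 1"
| "leaves (Node g s t) = leaves s + leaves t"

lemma leaves_pos: "0 < leaves t"
  by (induction t) auto

text \<open>\<open>cls\<close> is the state that a deterministic bottom-up automaton reaches at the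
  root. Only the step at inner nodes is constrained; leaves may receive their states in any
  way.\<close>

lemma tree_pumping:
  fixes cls :: "'l tree \<Rightarrow> 'q"
  assumes fin: "finite (range cls)"
    and cong: "\<And>g s t s' t'. cls s = cls s' \<Longrightarrow> cls t = cls t' \<Longrightarrow> cls (Node g s t) = cls (Node g s' t')"
  obtains \<theta> p :: nat where "0 < p"
    and "\<And>t. \<theta> \<le> leaves t \<Longrightarrow> \<exists>t'. cls t' = cls t \<and> leaves t' = leaves t + p"
proof -
  \<comment> \<open>\<open>ctx q q' m\<close> stands for a context around a hole that turns class
    \<open>q'\<close> into \<open>q\<close> and adds \<open>m\<close> leaves; only its effect on
    trees is recorded. It holds vacuously when \<open>q'\<close> is no class, hence the restriction
    to \<open>range cls\<close> in \<open>D\<close> and \<open>L\<close>.\<close>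
  define ctx where "ctx q q' m \<longleftrightarrow> (\<forall>t'. cls t' = q' \<longrightarrow> (\<exists>t. cls t = q \<and> leaves t = leaves t' + m))"
    for q q' m
  define D where "D q = {q' \<in> range cls. \<exists>m. ctx q q' m}" for q
  define L where "L = {q \<in> range cls. \<exists>d>0. ctx q q d}"
  have ctx_refl: "ctx q q 0" for q
    by (auto simp: ctx_def)
  have ctx_trans: "ctx q q'' (m + m')" if "ctx q q' m" "ctx q' q'' m'" for q q' q'' m m'
    using that unfolding ctx_def by (metis add.assoc add.commute)
  have ctx_left: "ctx (cls (Node g s t)) (cls s) (leaves t)" for g s t
    unfolding ctx_def using cong by (metis leaves.simps(2))
  have ctx_right: "ctx (cls (Node g s t)) (cls t) (leaves s)" for g s t
    unfolding ctx_def using cong by (metis leaves.simps(2) add.commute)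
  have finD: "finite (D q)" for q
    using fin by (auto simp: D_def intro: finite_subset)
  have D_mono: "D q' \<subseteq> D q" if "ctx q q' m" for q q' m
    using ctx_trans[OF that] by (auto simp: D_def)
  text \<open>A tree without a class on a loop repeats no class along a branch, so its height is bounded.\<close>
  have loop: "(\<exists>q\<in>L. \<exists>t' m. cls t' = q \<and> ctx (cls t) q m \<and> leaves t = leaves t' + m)
      \<or> leaves t \<le> 2 ^ card (D (cls t))" for t
  proof (induction t)
    case (Leaf l)
    then show ?case by simp
  next
    case (Node g s t)
    let ?q = "cls (Node g s t)"
    show ?case
    proof (rule disjCI)
      assume small: "\<not> leaves (Node g s t) \<le> 2 ^ card (D ?q)"
      show "\<exists>q\<in>L. \<exists>t' m. cls t' = q \<and> ctx ?q q m \<and> leaves (Node g s t) = leaves t' + m"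
      proof (cases "?q \<in> L")
        case True
        then show ?thesis using ctx_refl[of ?q] by force
      next
        case False
        \<comment> \<open>\<open>?q\<close> lies on no loop, so it cannot be reached from the class
          of a child. \<open>D\<close> loses \<open>?q\<close> on the way down, and the bound for a
          child is at most half of that for the node.\<close>
        have bound: "2 * 2 ^ card (D (cls u)) \<le> (2::nat) ^ card (D ?q)"
          if u: "ctx ?q (cls u) m" "0 < m" for u m
        proof -
          have "\<not> ctx (cls u) ?q m'" for m'
            using False ctx_trans[OF u(1), of ?q m'] u(2)
            by (auto simp: L_def dest!: spec[of _ "m + m'"])
          then have "?q \<notin> D (cls u)"
            by (simp add: D_def)
          moreover have "?q \<in> D ?q" using ctx_refl by (auto simp: D_def)
          ultimately have "D (cls u) \<subset> D ?q" using D_mono[OF u(1)] by blast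
          then have "Suc (card (D (cls u))) \<le> card (D ?q)"
            using psubset_card_mono[OF finD] by (simp add: Suc_leI)
          then have "(2::nat) ^ Suc (card (D (cls u))) \<le> 2 ^ card (D ?q)"
            by (intro power_increasing) auto
          then show ?thesis by simp
        qed
        have "\<not> (leaves s \<le> 2 ^ card (D (cls s)) \<and> leaves t \<le> 2 ^ card (D (cls t)))"
          using small bound[OF ctx_left leaves_pos] bound[OF ctx_right leaves_pos] by fastforce
        then consider q t' m where "q \<in> L" "cls t' = q" "ctx (cls s) q m" "leaves s = leaves t' + m"
          | q t' m where "q \<in> L" "cls t' = q" "ctx (cls t) q m" "leaves t = leaves t' + m"
          using Node.IH by blast
        then show ?thesis
        proof cases
          case 1
          then show ?thesis using ctx_trans[OF ctx_left 1(3), of g t]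
            by (intro bexI[of _ q] exI[of _ t'] exI[of _ "leaves t + m"]) auto
        next
          case 2
          then show ?thesis using ctx_trans[OF ctx_right 2(3), of g s]
            by (intro bexI[of _ q] exI[of _ t'] exI[of _ "leaves s + m"]) auto
        qed
      qed
    qed
  qed
  define d where "d q = (SOME d. 0 < d \<and> ctx q q d)" for q
  have d: "0 < d q" "ctx q q (d q)" if "q \<in> L" for q
    using that someI_ex[of "\<lambda>d. 0 < d \<and> ctx q q d"] by (auto simp: L_def d_def)
  have finL: "finite L" using fin by (simp add: L_def)
  define p where "p = prod d L"
  have ctx_mult: "ctx q q (k * d q)" if "q \<in> L" for q k
  proof (induction k)
    case (Suc k)
    show ?case using ctx_trans[OF d(2)[OF that] Suc] by simp
  qed (simp add: ctx_refl)
  have ctx_p: "ctx q q p" if "q \<in> L" for q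
  proof -
    have "d q dvd p" using finL that by (simp add: p_def dvd_prodI)
    then obtain k where "p = k * d q" by (metis dvdE mult.commute)
    then show ?thesis using ctx_mult[OF that] by simp
  qed
  show thesis
  \<comment> \<open>Since \<open>D q\<close> is contained in \<open>range cls\<close>, one leaf more
    than \<open>2 ^ card (range cls)\<close> rules out the second alternative of
    \<open>loop\<close>.\<close>
  proof (rule that[of p "Suc (2 ^ card (range cls))"])
    show "0 < p" using d by (auto simp: p_def prod_pos)
    fix t :: "'l tree" assume big: "Suc (2 ^ card (range cls)) \<le> leaves t"
    have "card (D (cls t)) \<le> card (range cls)"
      using fin by (intro card_mono) (auto simp: D_def)
    then have "(2::nat) ^ card (D (cls t)) \<le> 2 ^ card (range cls)"
      by (intro power_increasing) auto
    then have "\<not> leaves t \<le> 2 ^ card (D (cls t))"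
      using big by linarith
    then obtain q t' m where q: "q \<in> L" "cls t' = q" "ctx (cls t) q m" "leaves t = leaves t' + m"
      using loop[of t] by blast
    \<comment> \<open>The loop at \<open>q\<close>, run until it has gained \<open>p\<close> leaves,
      is inserted between the outer context and \<open>t'\<close>.\<close>
    from ctx_trans[OF q(3) ctx_p[OF q(1)]] q(2,4)
    show "\<exists>t'. cls t' = cls t \<and> leaves t' = leaves t + p"
      unfolding ctx_def by (metis add.assoc)
  qed
qed

section \<open>Recognizable properties of trees with subsets of leaves\<close>

text \<open>A leaf is addressed by the path leading to it; \<open>True\<close> means turning right.\<close>

primrec pos :: "'l tree \<Rightarrow> bool list set" where
  "pos (Leaf l) = {[]}"
| "pos (Node g s t) = (#) False ` pos s \<union> (#) True ` pos t"

fun lab :: "'l tree \<Rightarrow> bool list \<Rightarrow> 'l" where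
  "lab (Leaf l) x = l"
| "lab (Node g s t) (b # x) = (if b then lab t x else lab s x)"
| "lab (Node g s t) [] = undefined"

lemma finite_pos: "finite (pos t)"
  by (induction t) auto

lemma card_pos: "card (pos t) = leaves t"
proof (induction t)
  case (Node g s t)
  have "card (pos (Node g s t)) = card ((#) False ` pos s) + card ((#) True ` pos t)"
    using finite_pos by (auto intro!: card_Un_disjoint)
  then show ?case using Node by (simp add: card_image)
qed simp

text \<open>The part of \<open>W\<close> seen from one child: the left quotient of each set by the
  letter \<open>b\<close>.\<close>

definition restr :: "bool \<Rightarrow> ('i \<Rightarrow> bool list set) \<Rightarrow> 'i \<Rightarrow> bool list set" where
  "restr b W i = (#) b -` W i"

lemma restr_iff [simp]: "x \<in> restr b W i \<longleftrightarrow> b # x \<in> W i"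
  by (simp add: restr_def)

lemma restr_upd: "restr b (W(i := A)) = (restr b W)(i := (#) b -` A)"
  by (auto simp: restr_def fun_eq_iff)

lemma restr_empty: "restr b (\<lambda>_. {}) = (\<lambda>_. {})"
  by (auto simp: restr_def fun_eq_iff)

text \<open>The state at a node may depend only on the glue and on the states of the children.
  Nothing is required at leaves, so infinitely many labels are allowed as long as finitely many
  states occur.\<close>

definition compositional :: "('l tree \<Rightarrow> ('i \<Rightarrow> bool list set) \<Rightarrow> 'q) \<Rightarrow> bool" where
  "compositional f \<longleftrightarrow> (\<forall>g s t s' t' W W'.
     f s (restr False W) = f s' (restr False W') \<longrightarrow> f t (restr True W) = f t' (restr True W') \<longrightarrow>
     f (Node g s t) W = f (Node g s' t') W')"

text \<open>States are natural numbers because a definition cannot quantify over the type of states;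
  \<open>recogI\<close> admits any type.\<close>

definition recog :: "('l tree \<Rightarrow> ('i \<Rightarrow> bool list set) \<Rightarrow> bool) \<Rightarrow> bool" where
  "recog \<Phi> \<longleftrightarrow> (\<exists>f :: 'l tree \<Rightarrow> ('i \<Rightarrow> bool list set) \<Rightarrow> nat.
     finite (range (case_prod f)) \<and> compositional f \<and>
     (\<forall>t W t' W'. f t W = f t' W' \<longrightarrow> \<Phi> t W = \<Phi> t' W'))"

lemma compositionalI:
  assumes "\<And>g s t s' t' W W'. f s (restr False W) = f s' (restr False W') \<Longrightarrow>
    f t (restr True W) = f t' (restr True W') \<Longrightarrow> f (Node g s t) W = f (Node g s' t') W'"
  shows "compositional f"
  using assms unfolding compositional_def by blast

lemma compositionalD:
  assumes "compositional f" "f s (restr False W) = f s' (restr False W')"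
    "f t (restr True W) = f t' (restr True W')"
  shows "f (Node g s t) W = f (Node g s' t') W'"
  using assms unfolding compositional_def by blast

text \<open>The definition of \<open>recog\<close> speaks of states only through equality, so
  finitely many states can be renamed injectively to natural numbers.\<close>

lemma recogI:
  fixes f :: "'l tree \<Rightarrow> ('i \<Rightarrow> bool list set) \<Rightarrow> 'q"
  assumes fin: "finite (range (case_prod f))" and comp: "compositional f"
    and det: "\<And>t W t' W'. f t W = f t' W' \<Longrightarrow> \<Phi> t W = \<Phi> t' W'"
  shows "recog \<Phi>"
proof -
  obtain e :: "'q \<Rightarrow> nat" where e: "inj_on e (range (case_prod f))"
    using finite_imp_inj_to_nat_seg[OF fin] by metis
  have e_iff: "e (f t W) = e (f t' W') \<longleftrightarrow> f t W = f t' W'" for t W t' W'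
    using e by (auto simp: inj_on_def)
  have "range (\<lambda>(t, W). e (f t W)) = e ` range (case_prod f)"
    by auto
  then have "finite (range (\<lambda>(t, W). e (f t W)))"
    using fin by simp
  moreover have "compositional (\<lambda>t W. e (f t W))"
    using comp unfolding compositional_def e_iff .
  ultimately show ?thesis
    unfolding recog_def using det e_iff by (intro exI[of _ "\<lambda>t W. e (f t W)"]) blast
qed

lemma recogI_finite:
  fixes f :: "'l tree \<Rightarrow> ('i \<Rightarrow> bool list set) \<Rightarrow> 'q::finite"
  assumes "compositional f" "\<And>t W t' W'. f t W = f t' W' \<Longrightarrow> \<Phi> t W = \<Phi> t' W'"
  shows "recog \<Phi>"
  by (rule recogI[OF _ assms]) simp_all

section \<open>Closure under Boolean connectives and quantifiers\<close>

lemma recog_not: "recog \<Phi> \<Longrightarrow> recog (\<lambda>t W. \<not> \<Phi> t W)"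
  unfolding recog_def by metis

text \<open>The product automaton runs both invariants side by side.\<close>

lemma recog_conj:
  assumes "recog \<Phi>" "recog \<Psi>"
  shows "recog (\<lambda>t W. \<Phi> t W \<and> \<Psi> t W)"
proof -
  obtain f where f: "finite (range (case_prod f))" "compositional f"
    "\<And>t W t' W'. (f t W :: nat) = f t' W' \<Longrightarrow> \<Phi> t W = \<Phi> t' W'"
    using assms(1) unfolding recog_def by blast
  obtain h where h: "finite (range (case_prod h))" "compositional h"
    "\<And>t W t' W'. (h t W :: nat) = h t' W' \<Longrightarrow> \<Psi> t W = \<Psi> t' W'"
    using assms(2) unfolding recog_def by blast
  show ?thesis
  proof (rule recogI[of "\<lambda>t W. (f t W, h t W)"])
    have "range (\<lambda>(t, W). (f t W, h t W)) \<subseteq> range (case_prod f) \<times> range (case_prod h)"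
      by auto
    then show "finite (range (\<lambda>(t, W). (f t W, h t W)))"
      using f(1) h(1) finite_subset by blast
    show "compositional (\<lambda>t W. (f t W, h t W))"
      by (rule compositionalI) (auto intro: compositionalD[OF f(2)] compositionalD[OF h(2)])
    fix t W t' W' assume "(f t W, h t W) = (f t' W', h t' W')"
    then show "(\<Phi> t W \<and> \<Psi> t W) = (\<Phi> t' W' \<and> \<Psi> t' W')"
      using f(3)[of t W t' W'] h(3)[of t W t' W'] by simp
  qed
qed

lemma recog_disj: "recog \<Phi> \<Longrightarrow> recog \<Psi> \<Longrightarrow> recog (\<lambda>t W. \<Phi> t W \<or> \<Psi> t W)"
  using recog_not[OF recog_conj[OF recog_not recog_not], of \<Phi> \<Psi>] by simp

lemma recog_imp: "recog \<Phi> \<Longrightarrow> recog \<Psi> \<Longrightarrow> recog (\<lambda>t W. \<Phi> t W \<longrightarrow> \<Psi> t W)"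
  using recog_not[OF recog_conj[OF _ recog_not], of \<Phi> \<Psi>] by simp

lemma recog_iff: "recog \<Phi> \<Longrightarrow> recog \<Psi> \<Longrightarrow> recog (\<lambda>t W. \<Phi> t W \<longleftrightarrow> \<Psi> t W)"
  unfolding iff_conv_conj_imp by (intro recog_conj recog_imp)

text \<open>As in the powerset construction for automata, collect the values of \<open>f\<close> over all choices of \<open>A\<close>.\<close>

lemma recog_exS:
  fixes i :: 'i
  assumes "recog \<Phi>"
  shows "recog (\<lambda>t W. \<exists>A\<subseteq>pos t. \<Phi> t (W(i := A)))"
proof -
  obtain f where f: "finite (range (case_prod f))" "compositional f"
    "\<And>t W t' W'. (f t W :: nat) = f t' W' \<Longrightarrow> \<Phi> t W = \<Phi> t' W'"
    using assms unfolding recog_def by blast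
  define F where "F t W = {f t (W(i := A)) | A. A \<subseteq> pos t}" for t W
  \<comment> \<open>A choice \<open>A\<close> below a node splits into one choice for each child.
    Each of them has a counterpart with the same value in the other tree, and the two counterparts
    are put together to \<open>A'\<close>.\<close>
  have sub: "F (Node g s t) W \<subseteq> F (Node g s' t') W'"
    if eq: "F s (restr False W) = F s' (restr False W')" "F t (restr True W) = F t' (restr True W')"
    for g s t s' t' W W'
  proof
    fix n assume "n \<in> F (Node g s t) W"
    then obtain A where A: "A \<subseteq> pos (Node g s t)" "n = f (Node g s t) (W(i := A))"
      by (auto simp: F_def)
    have "f s ((restr False W)(i := (#) False -` A)) \<in> F s (restr False W)"
      "f t ((restr True W)(i := (#) True -` A)) \<in> F t (restr True W)"
      using A(1) unfolding F_def by force+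
    then obtain B C where B: "B \<subseteq> pos s'"
        "f s ((restr False W)(i := (#) False -` A)) = f s' ((restr False W')(i := B))"
      and C: "C \<subseteq> pos t'" "f t ((restr True W)(i := (#) True -` A)) = f t' ((restr True W')(i := C))"
      unfolding eq by (auto simp: F_def)
    define A' where "A' = (#) False ` B \<union> (#) True ` C"
    have A': "(#) False -` A' = B" "(#) True -` A' = C"
      by (auto simp: A'_def)
    have "n = f (Node g s' t') (W'(i := A'))"
      unfolding A(2) by (rule compositionalD[OF f(2)]) (simp_all add: restr_upd A' B C)
    moreover have "A' \<subseteq> pos (Node g s' t')"
      using B C by (auto simp: A'_def)
    ultimately show "n \<in> F (Node g s' t') W'"
      by (auto simp: F_def)
  qed
  show ?thesis
  proof (rule recogI[of F])
    have "f t W \<in> range (case_prod f)" for t W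
      by (rule range_eqI[of _ _ "(t, W)"]) simp
    then have "range (case_prod F) \<subseteq> Pow (range (case_prod f))"
      by (auto simp: F_def)
    then show "finite (range (case_prod F))"
      using f(1) finite_subset by blast
    show "compositional F"
      by (rule compositionalI) (intro equalityI sub; simp)
    fix t W t' W' assume "F t W = F t' W'"
    \<comment> \<open>Acceptance can be read off from \<open>F t W\<close>: by \<open>f(3)\<close>,
      a value that \<open>f\<close> takes at one pair satisfying \<Phi> is taken only at such
      pairs.\<close>
    moreover have "(\<exists>A\<subseteq>pos t. \<Phi> t (W(i := A))) \<longleftrightarrow> (\<exists>n\<in>F t W. \<exists>u X. f u X = n \<and> \<Phi> u X)" for t W
    proof
      assume "\<exists>A\<subseteq>pos t. \<Phi> t (W(i := A))"
      then show "\<exists>n\<in>F t W. \<exists>u X. f u X = n \<and> \<Phi> u X" unfolding F_def by auto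
    next
      assume "\<exists>n\<in>F t W. \<exists>u X. f u X = n \<and> \<Phi> u X"
      then obtain A u X where "A \<subseteq> pos t" "f u X = f t (W(i := A))" "\<Phi> u X"
        unfolding F_def by auto
      then show "\<exists>A\<subseteq>pos t. \<Phi> t (W(i := A))" using f(3)[of u X t "W(i := A)"] by auto
    qed
    ultimately show "(\<exists>A\<subseteq>pos t. \<Phi> t (W(i := A))) = (\<exists>A\<subseteq>pos t'. \<Phi> t' (W'(i := A)))"
      by simp
  qed
qed

text \<open>Counting truncated at 2 needs three states, and the truncated counts of the children
  determine that of the node.\<close>

lemma recog_singleton: "recog (\<lambda>t W. card (W i \<inter> pos t) = 1)"
proof (rule recogI[of "\<lambda>t W. min 2 (card (W i \<inter> pos t))"])
  have "range (\<lambda>(t :: 'a tree, W). min 2 (card (W i \<inter> pos t))) \<subseteq> {..2}"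
    by auto
  then show "finite (range (\<lambda>(t :: 'a tree, W). min 2 (card (W i \<inter> pos t))))"
    using finite_subset by blast
  have card: "card (W i \<inter> pos (Node g s t)) =
      card (restr False W i \<inter> pos s) + card (restr True W i \<inter> pos t)" for g W and s t :: "'a tree"
  proof -
    have "W i \<inter> pos (Node g s t) =
        (#) False ` (restr False W i \<inter> pos s) \<union> (#) True ` (restr True W i \<inter> pos t)"
      by auto
    moreover have "card ((#) False ` (restr False W i \<inter> pos s) \<union> (#) True ` (restr True W i \<inter> pos t)) =
        card ((#) False ` (restr False W i \<inter> pos s)) + card ((#) True ` (restr True W i \<inter> pos t))"
      by (rule card_Un_disjoint) (auto simp: finite_pos)
    ultimately show ?thesis by (simp add: card_image)
  qed
  show "compositional (\<lambda>(t :: 'a tree) W. min 2 (card (W i \<inter> pos t)))"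
  proof (rule compositionalI)
    fix g and s t s' t' :: "'a tree" and W W'
    assume "min 2 (card (restr False W i \<inter> pos s)) = min 2 (card (restr False W' i \<inter> pos s'))"
      "min 2 (card (restr True W i \<inter> pos t)) = min 2 (card (restr True W' i \<inter> pos t'))"
    then show "min 2 (card (W i \<inter> pos (Node g s t))) = min 2 (card (W' i \<inter> pos (Node g s' t')))"
      unfolding card[of W g s t] card[of W' g s' t'] by (auto simp: min_def split: if_splits)
  qed
qed (auto simp: min_def split: if_splits)

text \<open>An element is a singleton set, so the quantifier over elements is a set quantifier
  relativized to a recognizable property.\<close>

lemma recog_ex:
  assumes "recog \<Phi>"
  shows "recog (\<lambda>t W. \<exists>a\<in>pos t. \<Phi> t (W(i := {a})))"
proof -
  have eq: "(\<exists>a\<in>pos t. \<Phi> t (W(i := {a}))) \<longleftrightarrow>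
      (\<exists>A\<subseteq>pos t. card ((W(i := A)) i \<inter> pos t) = 1 \<and> \<Phi> t (W(i := A)))" (is "?L \<longleftrightarrow> ?R") for t W
  proof
    assume ?L
    then obtain a where "a \<in> pos t" "\<Phi> t (W(i := {a}))" by blast
    then show ?R by (intro exI[of _ "{a}"]) simp
  next
    assume ?R
    then obtain A where A: "A \<subseteq> pos t" "card (A \<inter> pos t) = 1" "\<Phi> t (W(i := A))" by auto
    then obtain a where "A = {a}" by (metis card_1_singletonE inf.absorb1)
    then show ?L using A by auto
  qed
  show ?thesis
    unfolding eq by (rule recog_exS[OF recog_conj[OF recog_singleton assms]])
qed

lemma recog_all:
  assumes "recog \<Phi>"
  shows "recog (\<lambda>t W. \<forall>a\<in>pos t. \<Phi> t (W(i := {a})))"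
  using recog_not[OF recog_ex[OF recog_not[OF assms], of i]] by simp

lemma recog_allS:
  assumes "recog \<Phi>"
  shows "recog (\<lambda>t W. \<forall>A\<subseteq>pos t. \<Phi> t (W(i := A)))"
  using recog_not[OF recog_exS[OF recog_not[OF assms], of i]] by simp

text \<open>The leaves of a node are those of its children, with the same labels, so the truth value
  itself serves as the state. Predicate symbols use \<open>Q\<close>; membership is the case of a
  trivial \<open>Q\<close>.\<close>

lemma recog_ex_lab: "recog (\<lambda>t W. \<exists>x\<in>pos t. Q (lab t x) \<and> x \<in> W i \<and> x \<in> W j)"
proof (rule recogI_finite)
  have eq: "(\<exists>x\<in>pos (Node g s t). Q (lab (Node g s t) x) \<and> x \<in> W i \<and> x \<in> W j) \<longleftrightarrow>
      (\<exists>x\<in>pos s. Q (lab s x) \<and> x \<in> restr False W i \<and> x \<in> restr False W j) \<or>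
      (\<exists>x\<in>pos t. Q (lab t x) \<and> x \<in> restr True W i \<and> x \<in> restr True W j)" for g s t W
    by (simp add: bex_Un)
  show "compositional (\<lambda>t W. \<exists>x\<in>pos t. Q (lab t x) \<and> x \<in> W i \<and> x \<in> W j)"
    by (rule compositionalI) (simp only: eq)
qed

section \<open>The functional graph described by a tree\<close>

text \<open>
  A tree describes a rooted graph with a set of marked vertices, given by the second components of
  the labels. \<open>Attach\<close> adds an edge from the root of the right graph to the root of the left
  one, and keeps all marks. \<open>Adjoin\<close> adds edges from the root of the right graph to its marked
  vertices, and then forgets this root and these marks. In the end, the root that is left over is
  connected to the remaining marked vertices as well. In this way every cycle of a functional graph
  is obtained from a rooted tree by adding an edge that starts in the root.
\<close>

primrec root :: "'l tree \<Rightarrow> bool list" where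
  "root (Leaf l) = []"
| "root (Node g s t) = False # root s"

primrec marks :: "('l \<times> bool) tree \<Rightarrow> bool list set" where
  "marks (Leaf l) = (if snd l then {[]} else {})"
| "marks (Node g s t) = (#) False ` marks s \<union> (case g of Attach \<Rightarrow> (#) True ` marks t | Adjoin \<Rightarrow> {})"

primrec edges :: "('l \<times> bool) tree \<Rightarrow> (bool list \<times> bool list) set" where
  "edges (Leaf l) = {}"
| "edges (Node g s t) =
     map_prod ((#) False) ((#) False) ` edges s \<union> map_prod ((#) True) ((#) True) ` edges t \<union>
     (case g of Attach \<Rightarrow> {(True # root t, False # root s)}
      | Adjoin \<Rightarrow> (\<lambda>y. (True # root t, True # y)) ` marks t)"

definition graph :: "('l \<times> bool) tree \<Rightarrow> (bool list \<times> bool list) set" where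
  "graph t = edges t \<union> Pair (root t) ` marks t"

lemma root_in_pos: "root t \<in> pos t"
  by (induction t) auto

lemma marks_subset_pos: "marks t \<subseteq> pos t"
  by (induction t) (auto split: glue.splits)

lemma edges_subset_pos: "edges t \<subseteq> pos t \<times> pos t"
proof (induction t)
  case (Node g s t)
  then show ?case
    using root_in_pos[of s] root_in_pos[of t] marks_subset_pos[of t] by (auto split: glue.splits)
qed simp

lemma graph_subset_pos: "graph t \<subseteq> pos t \<times> pos t"
  using edges_subset_pos[of t] root_in_pos[of t] marks_subset_pos[of t] by (auto simp: graph_def)

text \<open>Edges added higher up start in a root and end in a root or in a mark, so besides the
  edges already present the state records whether these vertices meet the two sets.\<close>

lemma recog_graph:
  fixes i j :: 'i
  shows "recog (\<lambda>(t :: ('l \<times> bool) tree) W. \<exists>(x, y)\<in>graph t. x \<in> W i \<and> y \<in> W j)"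
proof (rule recogI_finite)
  let ?f = "\<lambda>(t :: ('l \<times> bool) tree) (W :: 'i \<Rightarrow> _). (\<exists>(x, y)\<in>edges t. x \<in> W i \<and> y \<in> W j, root t \<in> W i, root t \<in> W j, \<exists>y\<in>marks t. y \<in> W j)"
  have E: "(\<exists>(x, y)\<in>edges (Node g s t). x \<in> W i \<and> y \<in> W j) \<longleftrightarrow>
      (\<exists>(x, y)\<in>edges s. x \<in> restr False W i \<and> y \<in> restr False W j) \<or>
      (\<exists>(x, y)\<in>edges t. x \<in> restr True W i \<and> y \<in> restr True W j) \<or>
      root t \<in> restr True W i \<and> (case g of Attach \<Rightarrow> root s \<in> restr False W j
         | Adjoin \<Rightarrow> (\<exists>y\<in>marks t. y \<in> restr True W j))"
    for g s and W :: "'i \<Rightarrow> _" and t :: "('l \<times> bool) tree"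
    by (cases g) (auto simp: bex_Un case_prod_unfold)
  have M: "(\<exists>y\<in>marks (Node g s t). y \<in> W j) \<longleftrightarrow> (\<exists>y\<in>marks s. y \<in> restr False W j) \<or>
      g = Attach \<and> (\<exists>y\<in>marks t. y \<in> restr True W j)" for g s and W :: "'i \<Rightarrow> _" and t :: "('l \<times> bool) tree"
    by (cases g) auto
  have R: "root (Node g s t) \<in> W k \<longleftrightarrow> root s \<in> restr False W k"
    for g s k and W :: "'i \<Rightarrow> _" and t :: "('l \<times> bool) tree"
    by simp
  show "compositional ?f"
  proof (rule compositionalI)
    fix g and s t s' t' :: "('l \<times> bool) tree" and W W' :: "'i \<Rightarrow> _"
    assume "?f s (restr False W) = ?f s' (restr False W')" "?f t (restr True W) = ?f t' (restr True W')"
    then show "?f (Node g s t) W = ?f (Node g s' t') W'"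
      unfolding E M R prod.inject by (cases g) (simp_all only: glue.case)
  qed
  fix t t' :: "('l \<times> bool) tree" and W W' :: "'i \<Rightarrow> _"
  have G: "(\<exists>(x, y)\<in>graph t. x \<in> W i \<and> y \<in> W j) \<longleftrightarrow>
      (\<exists>(x, y)\<in>edges t. x \<in> W i \<and> y \<in> W j) \<or> root t \<in> W i \<and> (\<exists>y\<in>marks t. y \<in> W j)"
    for W :: "'i \<Rightarrow> _" and t :: "('l \<times> bool) tree"
    unfolding graph_def by blast
  assume "?f t W = ?f t' W'"
  then show "(\<exists>(x, y)\<in>graph t. x \<in> W i \<and> y \<in> W j) = (\<exists>(x, y)\<in>graph t'. x \<in> W' i \<and> y \<in> W' j)"
    unfolding G prod.inject by (simp only:)
qed

section \<open>Monadic second-order properties are recognizable\<close>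

text \<open>An arbitrary tree may leave a vertex with no or several outgoing edges. The quantifiers
  are bounded by \<open>pos t\<close> so that the closure properties of \<open>recog\<close>
  apply.\<close>

definition functional :: "('l \<times> bool) tree \<Rightarrow> bool" where
  "functional t \<longleftrightarrow> (\<forall>a\<in>pos t. \<exists>b\<in>pos t. \<forall>c\<in>pos t. (a, c) \<in> graph t \<longleftrightarrow> c = b)"

text \<open>The function is meaningful only for functional trees. The first component of a label
  holds the predicates true at the leaf, the second one is the mark.\<close>

definition struct_of :: "('p set \<times> bool) tree \<Rightarrow> ('p, bool list) mstruct" where
  "struct_of t = \<lparr>universe = pos t, func = (\<lambda>a. THE b. (a, b) \<in> graph t),
     prd = (\<lambda>p. {x \<in> pos t. p \<in> fst (lab t x)})\<rparr>"

lemma universe_struct_of [simp]: "universe (struct_of t) = pos t"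
  by (simp add: struct_of_def)

lemma func_struct_of:
  assumes "functional t" "a \<in> pos t"
  shows "func (struct_of t) a \<in> pos t" and "(a, b) \<in> graph t \<longleftrightarrow> func (struct_of t) a = b"
proof -
  obtain b' where b': "b' \<in> pos t" "\<And>c. c \<in> pos t \<Longrightarrow> (a, c) \<in> graph t \<longleftrightarrow> c = b'"
    using assms unfolding functional_def by meson
  then have *: "(a, c) \<in> graph t \<longleftrightarrow> c = b'" for c
    using graph_subset_pos[of t] by blast
  then have "func (struct_of t) a = b'"
    by (simp add: struct_of_def *)
  then show "func (struct_of t) a \<in> pos t" "(a, b) \<in> graph t \<longleftrightarrow> func (struct_of t) a = b"
    using b'(1) *[of b] by auto
qed

lemma is_struct_struct_of: "functional t \<Longrightarrow> is_struct V (struct_of t)"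
  unfolding is_struct_def using root_in_pos[of t] func_struct_of(1)[of t]
  by (auto simp: struct_of_def)

text \<open>
  The value of a first-order variable \<open>x\<close> is encoded as a singleton interpretation of
  \<open>Elem x\<close>; the indices \<open>Aux n\<close> hold intermediate values of terms.
\<close>

datatype index = Elem nat | SetV nat | Aux nat

section \<open>Recognizing functional graphs\<close>

lemma recog_meet: "recog (\<lambda>t W. \<exists>x\<in>pos t. x \<in> W i \<and> x \<in> W j)"
  using recog_ex_lab[of "\<lambda>_. True" i j] by simp

text \<open>\<open>Aux 0\<close>, \<open>Aux 1\<close> and \<open>Aux 2\<close> play the roles of
  \<open>a\<close>, \<open>b\<close> and \<open>c\<close> in \<open>functional\<close>; the equation
  \<open>c = b\<close> becomes the meeting of their singletons.\<close>

lemma recog_functional: "recog (\<lambda>(t :: ('l \<times> bool) tree) (W :: index \<Rightarrow> bool list set). functional t)"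
proof -
  have "recog (\<lambda>(t :: ('l \<times> bool) tree) (W :: index \<Rightarrow> bool list set).
      (\<exists>(x, y)\<in>graph t. x \<in> W (Aux 0) \<and> y \<in> W (Aux 2)) \<longleftrightarrow>
      (\<exists>x\<in>pos t. x \<in> W (Aux 2) \<and> x \<in> W (Aux 1)))"
    by (rule recog_iff[OF recog_graph recog_meet])
  note recog_all[OF recog_ex[OF recog_all[OF this, of "Aux 2"], of "Aux 1"], of "Aux 0"]
  moreover have "(\<exists>(x, y)\<in>graph t. x = a \<and> y = c) \<longleftrightarrow> (a, c) \<in> graph t"
    for t :: "('l \<times> bool) tree" and a c
    by auto
  ultimately show ?thesis
    unfolding functional_def by (simp cong: ball_cong_simp)
qed

section \<open>Terms and formulas\<close>

lemma trm_val_struct_of: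
  assumes "functional t" "v (trm_var s) \<in> pos t"
  shows "trm_val (struct_of t) v s \<in> pos t"
  using assms by (induction s) (auto intro: func_struct_of)

text \<open>Recognizable properties speak of sets only, so a term is represented by the test whether
  its value lies in the set held by \<open>Aux n\<close>.\<close>

definition expresses_val ::
  "(('p set \<times> bool) tree \<Rightarrow> (index \<Rightarrow> bool list set) \<Rightarrow> bool) \<Rightarrow> trm \<Rightarrow> nat \<Rightarrow> bool" where
  "expresses_val \<Psi> s n \<longleftrightarrow> (\<forall>t W v. functional t \<longrightarrow> v (trm_var s) \<in> pos t \<longrightarrow>
     W (Elem (trm_var s)) = {v (trm_var s)} \<longrightarrow> (\<Psi> t W \<longleftrightarrow> trm_val (struct_of t) v s \<in> W (Aux n)))"

lemma expresses_valD:
  assumes "expresses_val \<Psi> s n" "functional t" "v (trm_var s) \<in> pos t"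
    "W (Elem (trm_var s)) = {v (trm_var s)}"
  shows "\<Psi> t W \<longleftrightarrow> trm_val (struct_of t) v s \<in> W (Aux n)"
  using assms unfolding expresses_val_def by blast

text \<open>Function application is replaced by an edge that leaves an intermediate vertex. Each
  level of nesting takes the next index, so that the set in \<open>Aux n\<close> is not
  overwritten.\<close>

lemma recog_trm: "\<exists>\<Psi>. recog \<Psi> \<and> expresses_val (\<Psi> :: ('p set \<times> bool) tree \<Rightarrow> _) s n"
proof (induction s arbitrary: n)
  case (Var x)
  have "expresses_val (\<lambda>(t :: ('p set \<times> bool) tree) W. \<exists>y\<in>pos t. y \<in> W (Elem x) \<and> y \<in> W (Aux n)) (Var x) n"
    by (simp add: expresses_val_def)
  with recog_meet[of "Elem x" "Aux n"] show ?case by (intro exI conjI)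
next
  case (Fn s)
  obtain \<Psi> where \<Psi>: "recog \<Psi>" "expresses_val (\<Psi> :: ('p set \<times> bool) tree \<Rightarrow> _) s (Suc n)"
    using Fn[of "Suc n"] by blast
  let ?\<Theta> = "\<lambda>(t :: ('p set \<times> bool) tree) W. \<exists>a\<in>pos t. \<Psi> t (W(Aux (Suc n) := {a})) \<and>
    (\<exists>(x, y)\<in>graph t. x \<in> (W(Aux (Suc n) := {a})) (Aux (Suc n)) \<and> y \<in> (W(Aux (Suc n) := {a})) (Aux n))"
  have "expresses_val ?\<Theta> (Fn s) n"
    unfolding expresses_val_def
  proof (intro allI impI)
    fix t :: "('p set \<times> bool) tree" and W v
    assume t: "functional t" and "v (trm_var (Fn s)) \<in> pos t"
      and "W (Elem (trm_var (Fn s))) = {v (trm_var (Fn s))}"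
    then have v: "v (trm_var s) \<in> pos t" and W: "W (Elem (trm_var s)) = {v (trm_var s)}" by simp_all
    define b where "b = trm_val (struct_of t) v s"
    have b: "b \<in> pos t" using trm_val_struct_of[of t v s] t v by (simp add: b_def)
    have "\<Psi> t (W(Aux (Suc n) := {a})) \<longleftrightarrow> a = b" for a
      using expresses_valD[OF \<Psi>(2) t, of v "W(Aux (Suc n) := {a})"] v W by (auto simp: b_def)
    moreover have "(\<exists>(x, y)\<in>graph t. x = b \<and> y \<in> W (Aux n)) \<longleftrightarrow> (\<exists>y. (b, y) \<in> graph t \<and> y \<in> W (Aux n))"
      by blast
    then have "(\<exists>(x, y)\<in>graph t. x = b \<and> y \<in> W (Aux n)) \<longleftrightarrow> func (struct_of t) b \<in> W (Aux n)"
      by (simp add: func_struct_of(2)[OF t b])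
    ultimately show "?\<Theta> t W \<longleftrightarrow> trm_val (struct_of t) v (Fn s) \<in> W (Aux n)"
      using b by (simp add: b_def[symmetric])
  qed
  moreover have "recog ?\<Theta>"
    by (rule recog_ex[OF recog_conj[OF \<Psi>(1) recog_graph[of "Aux (Suc n)" "Aux n"]], of "Aux (Suc n)"])
  ultimately show ?case by (intro exI conjI)
qed

text \<open>Agreement is asked for the free variables only: a bound variable receives its value by
  the update of \<open>W\<close> in the quantifier case.\<close>

definition expresses ::
  "(('p set \<times> bool) tree \<Rightarrow> (index \<Rightarrow> bool list set) \<Rightarrow> bool) \<Rightarrow> 'p mso \<Rightarrow> bool" where
  "expresses \<Psi> \<phi> \<longleftrightarrow> (\<forall>t W v X. functional t \<longrightarrow>
     (\<forall>x\<in>free_vars \<phi>. v x \<in> pos t \<and> W (Elem x) = {v x}) \<longrightarrow>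
     (\<forall>n\<in>free_set_vars \<phi>. W (SetV n) = X n) \<longrightarrow> (\<Psi> t W \<longleftrightarrow> sat (struct_of t) v X \<phi>))"

lemma expressesD:
  assumes "expresses \<Psi> \<phi>" "functional t" "\<And>x. x \<in> free_vars \<phi> \<Longrightarrow> v x \<in> pos t \<and> W (Elem x) = {v x}"
    "\<And>n. n \<in> free_set_vars \<phi> \<Longrightarrow> W (SetV n) = X n"
  shows "\<Psi> t W \<longleftrightarrow> sat (struct_of t) v X \<phi>"
  using assms unfolding expresses_def by blast

text \<open>Substitutes the term \<open>s\<close> for the element held in \<open>Aux 0\<close>:
  guess a leaf, check that it is the value of \<open>s\<close>, then test \<Theta>.\<close>

lemma recog_atom:
  assumes "recog \<Theta>"
  obtains \<Psi> where "recog \<Psi>"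
    and "\<And>(t :: ('p set \<times> bool) tree) W v. functional t \<Longrightarrow> v (trm_var s) \<in> pos t \<Longrightarrow>
     W (Elem (trm_var s)) = {v (trm_var s)} \<Longrightarrow>
     \<Psi> t W \<longleftrightarrow> \<Theta> t (W(Aux 0 := {trm_val (struct_of t) v s}))"
proof -
  obtain \<Psi> where \<Psi>: "recog \<Psi>" "expresses_val (\<Psi> :: ('p set \<times> bool) tree \<Rightarrow> _) s 0"
    using recog_trm[of s 0] by blast
  show thesis
  proof (rule that)
    show "recog (\<lambda>t W. \<exists>a\<in>pos t. \<Psi> t (W(Aux 0 := {a})) \<and> \<Theta> t (W(Aux 0 := {a})))"
      by (rule recog_ex[OF recog_conj[OF \<Psi>(1) assms]])
    fix t :: "('p set \<times> bool) tree" and W v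
    assume t: "functional t" and v: "v (trm_var s) \<in> pos t" and W: "W (Elem (trm_var s)) = {v (trm_var s)}"
    have "\<Psi> t (W(Aux 0 := {a})) \<longleftrightarrow> a = trm_val (struct_of t) v s" for a
      using expresses_valD[OF \<Psi>(2) t, of v "W(Aux 0 := {a})"] v W by auto
    then show "(\<exists>a\<in>pos t. \<Psi> t (W(Aux 0 := {a})) \<and> \<Theta> t (W(Aux 0 := {a}))) \<longleftrightarrow>
        \<Theta> t (W(Aux 0 := {trm_val (struct_of t) v s}))"
      using trm_val_struct_of[of t v s] t v by simp
  qed
qed

lemma recog_sat: "\<exists>\<Psi>. recog \<Psi> \<and> expresses \<Psi> (\<phi> :: 'p mso)"
proof (induction \<phi>)
  case (Eq s u)
  \<comment> \<open>Equality is treated as membership: \<Theta> asks whether the value of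
    \<open>u\<close> lies in \<open>Aux 0\<close>, where \<open>recog_atom\<close> puts the
    singleton of the value of \<open>s\<close>.\<close>
  obtain \<Theta> where \<Theta>: "recog \<Theta>" "expresses_val (\<Theta> :: ('p set \<times> bool) tree \<Rightarrow> _) u 0"
    using recog_trm[of u 0] by blast
  obtain \<Psi> where \<Psi>: "recog \<Psi>"
    "\<And>(t :: ('p set \<times> bool) tree) W v. functional t \<Longrightarrow> v (trm_var s) \<in> pos t \<Longrightarrow>
       W (Elem (trm_var s)) = {v (trm_var s)} \<Longrightarrow>
       \<Psi> t W \<longleftrightarrow> \<Theta> t (W(Aux 0 := {trm_val (struct_of t) v s}))"
    by (rule recog_atom[OF \<Theta>(1), of s]) (rule that)
  have "expresses \<Psi> (Eq s u)"
    unfolding expresses_def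
  proof (intro allI impI)
    fix t :: "('p set \<times> bool) tree" and W v and X :: "nat \<Rightarrow> bool list set"
    assume t: "functional t" and v: "\<forall>x\<in>free_vars (Eq s u :: 'p mso). v x \<in> pos t \<and> W (Elem x) = {v x}"
    have "\<Psi> t W \<longleftrightarrow> \<Theta> t (W(Aux 0 := {trm_val (struct_of t) v s}))"
      using \<Psi>(2)[of t v W] t v by simp
    also have "\<dots> \<longleftrightarrow> trm_val (struct_of t) v u = trm_val (struct_of t) v s"
      using expresses_valD[OF \<Theta>(2) t, of v "W(Aux 0 := {trm_val (struct_of t) v s})"] v by simp
    finally show "\<Psi> t W \<longleftrightarrow> sat (struct_of t) v X (Eq s u)" by auto
  qed
  with \<Psi>(1) show ?case by (intro exI conjI)
next
  case (Pred p s)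
  \<comment> \<open>Both indices of \<open>recog_ex_lab\<close> are \<open>Aux 0\<close>, since only
    the leaf that is the value of \<open>s\<close> is inspected.\<close>
  obtain \<Psi> where \<Psi>: "recog \<Psi>"
    "\<And>(t :: ('p set \<times> bool) tree) W v. functional t \<Longrightarrow> v (trm_var s) \<in> pos t \<Longrightarrow>
       W (Elem (trm_var s)) = {v (trm_var s)} \<Longrightarrow>
       \<Psi> t W \<longleftrightarrow> (\<exists>x\<in>pos t. p \<in> fst (lab t x) \<and> x \<in> (W(Aux 0 := {trm_val (struct_of t) v s})) (Aux 0)
         \<and> x \<in> (W(Aux 0 := {trm_val (struct_of t) v s})) (Aux 0))"
    by (rule recog_atom[OF recog_ex_lab[of "\<lambda>l. p \<in> fst l" "Aux 0" "Aux 0"], of s]) (rule that)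
  have "expresses \<Psi> (Pred p s)"
    unfolding expresses_def
  proof (intro allI impI)
    fix t :: "('p set \<times> bool) tree" and W v and X :: "nat \<Rightarrow> bool list set"
    assume "functional t" "\<forall>x\<in>free_vars (Pred p s). v x \<in> pos t \<and> W (Elem x) = {v x}"
    then have "\<Psi> t W \<longleftrightarrow> (\<exists>x\<in>pos t. p \<in> fst (lab t x) \<and> x = trm_val (struct_of t) v s)"
      using \<Psi>(2)[of t v W] by simp
    also have "\<dots> \<longleftrightarrow> trm_val (struct_of t) v s \<in> prd (struct_of t) p"
      by (auto simp: struct_of_def)
    finally show "\<Psi> t W \<longleftrightarrow> sat (struct_of t) v X (Pred p s)" by simp
  qed
  with \<Psi>(1) show ?case by (intro exI conjI)
next
  case (Mem s n)
  obtain \<Psi> where \<Psi>: "recog \<Psi>"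
    "\<And>(t :: ('p set \<times> bool) tree) W v. functional t \<Longrightarrow> v (trm_var s) \<in> pos t \<Longrightarrow>
       W (Elem (trm_var s)) = {v (trm_var s)} \<Longrightarrow>
       \<Psi> t W \<longleftrightarrow> (\<exists>x\<in>pos t. x \<in> (W(Aux 0 := {trm_val (struct_of t) v s})) (Aux 0)
         \<and> x \<in> (W(Aux 0 := {trm_val (struct_of t) v s})) (SetV n))"
    by (rule recog_atom[OF recog_meet[of "Aux 0" "SetV n"], of s]) (rule that)
  have "expresses \<Psi> (Mem s n)"
    unfolding expresses_def
  proof (intro allI impI)
    fix t :: "('p set \<times> bool) tree" and W v and X :: "nat \<Rightarrow> bool list set"
    assume "functional t" "\<forall>x\<in>free_vars (Mem s n :: 'p mso). v x \<in> pos t \<and> W (Elem x) = {v x}"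
      "\<forall>n\<in>free_set_vars (Mem s n :: 'p mso). W (SetV n) = X n"
    then show "\<Psi> t W \<longleftrightarrow> sat (struct_of t) v X (Mem s n)"
      using \<Psi>(2)[of t v W] trm_val_struct_of[of t v s] by simp
  qed
  with \<Psi>(1) show ?case by (intro exI conjI)
next
  case (Neg \<phi>)
  then obtain \<Psi> where \<Psi>: "recog \<Psi>" "expresses \<Psi> \<phi>" by blast
  then have "expresses (\<lambda>t W. \<not> \<Psi> t W) (Neg \<phi>)" by (simp add: expresses_def)
  with recog_not[OF \<Psi>(1)] show ?case by (intro exI conjI)
next
  case (Conj \<phi> \<psi>)
  then obtain \<Phi> \<Psi> where \<Psi>: "recog \<Phi>" "expresses \<Phi> \<phi>" "recog \<Psi>" "expresses \<Psi> \<psi>" by blast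
  have "expresses (\<lambda>t W. \<Phi> t W \<and> \<Psi> t W) (Conj \<phi> \<psi>)"
    unfolding expresses_def sat.simps
    by (intro allI impI arg_cong2[where f = "(\<and>)"] expressesD[OF \<Psi>(2)] expressesD[OF \<Psi>(4)]) auto
  with recog_conj[OF \<Psi>(1,3)] show ?case by (intro exI conjI)
next
  case (Disj \<phi> \<psi>)
  then obtain \<Phi> \<Psi> where \<Psi>: "recog \<Phi>" "expresses \<Phi> \<phi>" "recog \<Psi>" "expresses \<Psi> \<psi>" by blast
  have "expresses (\<lambda>t W. \<Phi> t W \<or> \<Psi> t W) (Disj \<phi> \<psi>)"
    unfolding expresses_def sat.simps
    by (intro allI impI arg_cong2[where f = "(\<or>)"] expressesD[OF \<Psi>(2)] expressesD[OF \<Psi>(4)]) auto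
  with recog_disj[OF \<Psi>(1,3)] show ?case by (intro exI conjI)
next
  case (Imp \<phi> \<psi>)
  then obtain \<Phi> \<Psi> where \<Psi>: "recog \<Phi>" "expresses \<Phi> \<phi>" "recog \<Psi>" "expresses \<Psi> \<psi>" by blast
  have "expresses (\<lambda>t W. \<Phi> t W \<longrightarrow> \<Psi> t W) (Imp \<phi> \<psi>)"
    unfolding expresses_def sat.simps
    by (intro allI impI arg_cong2[where f = "(\<longrightarrow>)"] expressesD[OF \<Psi>(2)] expressesD[OF \<Psi>(4)]) auto
  with recog_imp[OF \<Psi>(1,3)] show ?case by (intro exI conjI)
next
  case (Ex x \<phi>)
  then obtain \<Psi> where \<Psi>: "recog \<Psi>" "expresses \<Psi> \<phi>" by blast
  have "expresses (\<lambda>t W. \<exists>a\<in>pos t. \<Psi> t (W(Elem x := {a}))) (Ex x \<phi>)"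
    unfolding expresses_def sat.simps universe_struct_of
    by (intro allI impI bex_cong refl expressesD[OF \<Psi>(2)]) auto
  with recog_ex[OF \<Psi>(1)] show ?case by (intro exI conjI)
next
  case (All x \<phi>)
  then obtain \<Psi> where \<Psi>: "recog \<Psi>" "expresses \<Psi> \<phi>" by blast
  have "expresses (\<lambda>t W. \<forall>a\<in>pos t. \<Psi> t (W(Elem x := {a}))) (All x \<phi>)"
    unfolding expresses_def sat.simps universe_struct_of
    by (intro allI impI ball_cong refl expressesD[OF \<Psi>(2)]) auto
  with recog_all[OF \<Psi>(1)] show ?case by (intro exI conjI)
next
  case (ExS n \<phi>)
  then obtain \<Psi> where \<Psi>: "recog \<Psi>" "expresses \<Psi> \<phi>" by blast
  have "expresses (\<lambda>t W. \<exists>A\<subseteq>pos t. \<Psi> t (W(SetV n := A))) (ExS n \<phi>)"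
    unfolding expresses_def sat.simps universe_struct_of
    by (intro allI impI ex_cong1 conj_cong refl expressesD[OF \<Psi>(2)]) auto
  with recog_exS[OF \<Psi>(1)] show ?case by (intro exI conjI)
next
  case (AllS n \<phi>)
  then obtain \<Psi> where \<Psi>: "recog \<Psi>" "expresses \<Psi> \<phi>" by blast
  have "expresses (\<lambda>t W. \<forall>A\<subseteq>pos t. \<Psi> t (W(SetV n := A))) (AllS n \<phi>)"
    unfolding expresses_def sat.simps universe_struct_of
    by (intro allI impI all_cong1 imp_cong refl expressesD[OF \<Psi>(2)]) auto
  with recog_allS[OF \<Psi>(1)] show ?case by (intro exI conjI)
qed

text \<open>A closed formula can be evaluated at the empty interpretation, which every subtree
  inherits, so the invariant becomes a congruence on plain trees. \<open>functional\<close> is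
  pumped along with the formula because \<open>expresses\<close> is silent about other
  trees.\<close>

lemma spectrum_pumping:
  fixes \<phi> :: "'p mso"
  assumes "closed_mso \<phi>"
  obtains \<theta> p :: nat where "0 < p"
    and "\<And>t. \<theta> \<le> leaves t \<Longrightarrow> functional t \<Longrightarrow> models (struct_of t) \<phi> \<Longrightarrow>
      \<exists>t'. functional t' \<and> models (struct_of t') \<phi> \<and> leaves t' = leaves t + p"
proof -
  obtain \<Psi> where \<Psi>: "recog \<Psi>" "expresses \<Psi> \<phi>"
    using recog_sat by blast
  have models: "models (struct_of t) \<phi> \<longleftrightarrow> \<Psi> t (\<lambda>_. {})" if "functional t" for t
    using models_closed_iff[OF assms, of "struct_of t"] root_in_pos[of t] that
      expressesD[OF \<Psi>(2) that, of undefined "\<lambda>_. {}"] assms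
    by (auto simp: closed_mso_def)
  obtain f :: "('p set \<times> bool) tree \<Rightarrow> (index \<Rightarrow> bool list set) \<Rightarrow> nat"
    where fin: "finite (range (case_prod f))" and comp: "compositional f"
      and det: "\<And>t W t' W'. f t W = f t' W' \<Longrightarrow> (functional t \<and> \<Psi> t W) = (functional t' \<and> \<Psi> t' W')"
    using recog_conj[OF recog_functional \<Psi>(1)] unfolding recog_def by blast
  define cls where "cls t = f t (\<lambda>_. {})" for t
  have "range cls \<subseteq> range (case_prod f)"
    unfolding cls_def by (metis (no_types, lifting) case_prod_conv image_subsetI rangeI)
  then have fin_cls: "finite (range cls)"
    using fin finite_subset by blast
  have cong: "cls (Node g s t) = cls (Node g s' t')" if "cls s = cls s'" "cls t = cls t'" for g s t s' t'
    unfolding cls_def using that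
    by (intro compositionalD[OF comp]) (simp_all add: restr_empty cls_def)
  obtain \<theta> p where "0 < p"
    and pump: "\<And>t. \<theta> \<le> leaves t \<Longrightarrow> \<exists>t'. cls t' = cls t \<and> leaves t' = leaves t + p"
    using tree_pumping[OF fin_cls cong] by metis
  show thesis
  proof (rule that[OF \<open>0 < p\<close>])
    fix t assume t: "\<theta> \<le> leaves t" "functional t" "models (struct_of t) \<phi>"
    obtain t' where t': "cls t' = cls t" "leaves t' = leaves t + p"
      using pump[OF t(1)] by blast
    then have "functional t' \<and> \<Psi> t' (\<lambda>_. {})"
      using det[of t' "\<lambda>_. {}" t "\<lambda>_. {}"] t models[of t] by (simp add: cls_def)
    then show "\<exists>t'. functional t' \<and> models (struct_of t') \<phi> \<and> leaves t' = leaves t + p"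
      using models t' by blast
  qed
qed

section \<open>Every finite unary function is described by a tree\<close>

text \<open>The graphs described by trees, on an arbitrary carrier: vertices, edges, root and marks.
  The rules correspond to \<open>Leaf\<close>, \<open>Attach\<close> and
  \<open>Adjoin\<close>.\<close>

inductive built :: "'a set \<Rightarrow> ('a \<times> 'a) set \<Rightarrow> 'a \<Rightarrow> 'a set \<Rightarrow> bool" where
  single: "M \<subseteq> {a} \<Longrightarrow> built {a} {} a M"
| attach: "built A E r M \<Longrightarrow> built B F s N \<Longrightarrow> A \<inter> B = {} \<Longrightarrow>
    built (A \<union> B) (E \<union> F \<union> {(s, r)}) r (M \<union> N)"
| adjoin: "built A E r M \<Longrightarrow> built B F s N \<Longrightarrow> A \<inter> B = {} \<Longrightarrow>
    built (A \<union> B) (E \<union> F \<union> Pair s ` N) r M"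

text \<open>Copairing of two vertex maps on the disjoint union of the leaf addresses.\<close>

fun join :: "(bool list \<Rightarrow> 'a) \<Rightarrow> (bool list \<Rightarrow> 'a) \<Rightarrow> bool list \<Rightarrow> 'a" where
  "join h k [] = undefined"
| "join h k (b # x) = (if b then k x else h x)"

lemma join_image: "join h k ` (#) False ` A = h ` A" "join h k ` (#) True ` A = k ` A"
  by (simp_all add: image_image)

lemma map_prod_join_image:
  "map_prod (join h k) (join h k) ` map_prod ((#) False) ((#) False) ` A = map_prod h h ` A"
  "map_prod (join h k) (join h k) ` map_prod ((#) True) ((#) True) ` A = map_prod k k ` A"
  by (simp_all add: image_image map_prod_def case_prod_unfold)

lemma bij_betw_join:
  assumes "bij_betw h (pos s) A" "bij_betw k (pos t) B" "A \<inter> B = {}"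
  shows "bij_betw (join h k) (pos (Node g s t)) (A \<union> B)"
proof -
  have "bij_betw (join h k) ((#) False ` pos s) A" "bij_betw (join h k) ((#) True ` pos t) B"
    using assms(1,2) by (auto simp: bij_betw_def join_image inj_on_def)
  then show ?thesis
    using assms(3) by (simp add: bij_betw_combine)
qed

text \<open>The graph does not depend on the first components of the labels, so any labelling
  \<open>L\<close> of the vertices can be carried along.\<close>

lemma built_tree:
  assumes "built A E r M"
  shows "\<exists>(t :: ('l \<times> bool) tree) h. bij_betw h (pos t) A \<and> map_prod h h ` edges t = E \<and> h (root t) = r \<and>
    h ` marks t = M \<and> (\<forall>x\<in>pos t. fst (lab t x) = L (h x))"
  using assms
proof induction
  case (single M a)
  show ?case
    by (rule exI[of _ "Leaf (L a, a \<in> M)"], rule exI[of _ "\<lambda>_. a"]) (use single in auto)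
next
  case (attach A E r M B F s N)
  obtain t u :: "('l \<times> bool) tree" and h k
    where t: "bij_betw h (pos t) A" "map_prod h h ` edges t = E" "h (root t) = r" "h ` marks t = M"
      "\<forall>x\<in>pos t. fst (lab t x) = L (h x)"
    and u: "bij_betw k (pos u) B" "map_prod k k ` edges u = F" "k (root u) = s" "k ` marks u = N"
      "\<forall>x\<in>pos u. fst (lab u x) = L (k x)"
    using attach.IH by blast
  have "map_prod (join h k) (join h k) ` edges (Node Attach t u) = E \<union> F \<union> {(s, r)}"
    by (simp add: image_Un map_prod_join_image t u)
  moreover have "join h k ` marks (Node Attach t u) = M \<union> N"
    by (simp add: image_Un join_image t u)
  moreover have "\<forall>x\<in>pos (Node Attach t u). fst (lab (Node Attach t u) x) = L (join h k x)"
    using t(5) u(5) by auto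
  ultimately show ?case
    using bij_betw_join[OF t(1) u(1) attach.hyps(3)] t(3)
    by (intro exI[of _ "Node Attach t u"] exI[of _ "join h k"]) simp
next
  case (adjoin A E r M B F s N)
  obtain t u :: "('l \<times> bool) tree" and h k
    where t: "bij_betw h (pos t) A" "map_prod h h ` edges t = E" "h (root t) = r" "h ` marks t = M"
      "\<forall>x\<in>pos t. fst (lab t x) = L (h x)"
    and u: "bij_betw k (pos u) B" "map_prod k k ` edges u = F" "k (root u) = s" "k ` marks u = N"
      "\<forall>x\<in>pos u. fst (lab u x) = L (k x)"
    using adjoin.IH by blast
  have "map_prod (join h k) (join h k) ` (\<lambda>y. (True # root u, True # y)) ` marks u = Pair s ` N"
    by (simp add: image_image u(3) flip: u(4))
  then have "map_prod (join h k) (join h k) ` edges (Node Adjoin t u) = E \<union> F \<union> Pair s ` N"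
    by (simp add: image_Un map_prod_join_image t u)
  moreover have "join h k ` marks (Node Adjoin t u) = M"
    by (simp add: join_image t)
  moreover have "\<forall>x\<in>pos (Node Adjoin t u). fst (lab (Node Adjoin t u) x) = L (join h k x)"
    using t(5) u(5) by auto
  ultimately show ?case
    using bij_betw_join[OF t(1) u(1) adjoin.hyps(3)] t(3)
    by (intro exI[of _ "Node Adjoin t u"] exI[of _ "join h k"]) simp
qed

text \<open>Cut the edge from a child \<open>s\<close> of the root.\<close>

lemma built_rooted:
  assumes "finite A" "r \<in> A" "E \<subseteq> (A - {r}) \<times> A" "single_valued E" "\<And>x. x \<in> A \<Longrightarrow> (x, r) \<in> E\<^sup>*" "M \<subseteq> A"
  shows "built A E r M"
  using assms
proof (induction A arbitrary: r E M rule: finite_psubset_induct)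
  case (psubset A)
  note sv = single_valuedD[OF \<open>single_valued E\<close>]
  show ?case
  proof (cases "A = {r}")
    case True
    then have "E = {}" using psubset.prems(2) by auto
    then show ?thesis using True psubset.prems(5) by (simp add: single)
  next
    case False
    then obtain x where x: "x \<in> A" "x \<noteq> r" using psubset.prems(1) by blast
    with psubset.prems(4)[of x] obtain s where s: "(s, r) \<in> E" by (metis rtranclE)
    \<comment> \<open>\<open>B\<close> is the subtree hanging from \<open>s\<close>. The edge
      \<open>(s, r)\<close> is the only one between \<open>B\<close> and the rest \<open>C\<close>,
      so both parts inherit the hypotheses, with roots \<open>s\<close> and
      \<open>r\<close>.\<close>
    define B where "B = {x \<in> A. (x, s) \<in> E\<^sup>*}"
    define C where "C = A - B"
    have sA: "s \<in> A" "s \<noteq> r" using s psubset.prems(2) by auto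
    have sB: "s \<in> B" using sA by (simp add: B_def)
    have no_r: "(r, y) \<notin> E" for y using psubset.prems(2) by auto
    have "(r, s) \<notin> E\<^sup>*" using sA(2) no_r by (metis converse_rtranclE)
    then have rC: "r \<in> C" using psubset.prems(1) by (simp add: C_def B_def)
    have BC: "x = s \<and> y = r" if "(x, y) \<in> E" "x \<in> B" "y \<in> C" for x y
    proof -
      have "x = s"
      proof (rule ccontr)
        assume "x \<noteq> s"
        then obtain z where "(x, z) \<in> E" "(z, s) \<in> E\<^sup>*"
          using \<open>x \<in> B\<close> by (auto simp: B_def elim: converse_rtranclE)
        then show False using sv that by (auto simp: B_def C_def)
      qed
      then show ?thesis using sv s that(1) by blast
    qed
    have CB: "y \<in> C" if "(x, y) \<in> E" "x \<in> C" for x y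
      using that psubset.prems(2) by (auto simp: B_def C_def intro: converse_rtrancl_into_rtrancl)
    have "built C (E \<inter> C \<times> C) r (M \<inter> C)"
    proof (rule psubset.IH)
      fix x assume "x \<in> C"
      then have "(x, r) \<in> E\<^sup>*" using psubset.prems(4) by (simp add: C_def)
      then show "(x, r) \<in> (E \<inter> C \<times> C)\<^sup>*" using \<open>x \<in> C\<close>
      proof (induction rule: converse_rtrancl_induct)
        case (step y z)
        then show ?case using CB[of y z] by (auto intro: converse_rtrancl_into_rtrancl)
      qed simp
    qed (use psubset.prems(2) sB rC sA \<open>single_valued E\<close> in
        \<open>auto simp: C_def B_def intro: single_valued_subset\<close>)
    moreover have "built B (E \<inter> B \<times> B) s (M \<inter> B)"
    proof (rule psubset.IH)
      show "B \<subset> A" using rC psubset.prems(1) by (auto simp: B_def C_def)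
      have "(s, y) \<notin> E \<inter> B \<times> B" for y using sv[OF _ s] rC by (auto simp: C_def)
      then show "E \<inter> B \<times> B \<subseteq> (B - {s}) \<times> B" by auto
      fix x assume "x \<in> B"
      then have "(x, s) \<in> E\<^sup>*" by (simp add: B_def)
      then show "(x, s) \<in> (E \<inter> B \<times> B)\<^sup>*" using \<open>x \<in> B\<close>
      proof (induction rule: converse_rtrancl_induct)
        case (step y z)
        then have "z \<in> B" using psubset.prems(2) by (auto simp: B_def)
        then show ?case using step by (auto intro: converse_rtrancl_into_rtrancl)
      qed simp
    qed (use sB \<open>single_valued E\<close> in \<open>auto intro: single_valued_subset\<close>)
    ultimately have "built (C \<union> B) (E \<inter> C \<times> C \<union> E \<inter> B \<times> B \<union> {(s, r)}) r (M \<inter> C \<union> M \<inter> B)"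
      by (rule attach) (auto simp: C_def)
    moreover have "C \<union> B = A" by (auto simp: B_def C_def)
    moreover have "E \<inter> C \<times> C \<union> E \<inter> B \<times> B \<union> {(s, r)} = E"
    proof
      show "E \<inter> C \<times> C \<union> E \<inter> B \<times> B \<union> {(s, r)} \<subseteq> E" using s by blast
      show "E \<subseteq> E \<inter> C \<times> C \<union> E \<inter> B \<times> B \<union> {(s, r)}"
      proof
        fix e assume e: "e \<in> E"
        then obtain x y where "e = (x, y)" "x \<in> A" "y \<in> A" using psubset.prems(2) by auto
        then show "e \<in> E \<inter> C \<times> C \<union> E \<inter> B \<times> B \<union> {(s, r)}"
          using e BC[of x y] CB[of x y] \<open>C \<union> B = A\<close> by blast
      qed
    qed
    moreover have "M \<inter> C \<union> M \<inter> B = M" using \<open>C \<union> B = A\<close> psubset.prems(5) by blast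
    ultimately show ?thesis by simp
  qed
qed

text \<open>
  Cut the edge that leaves a vertex \<open>c\<close> on a cycle. The vertex is found by minimizing the number
  of vertices reachable from it.
\<close>

lemma built_function:
  assumes "finite U" "U \<noteq> {}" "\<And>x. x \<in> U \<Longrightarrow> f x \<in> U"
  shows "\<exists>E r M. built U E r M \<and> E \<union> Pair r ` M = (\<lambda>x. (x, f x)) ` U"
  using assms
proof (induction U rule: finite_psubset_induct)
  case (psubset U)
  define G where "G = (\<lambda>x. (x, f x)) ` U"
  have sv: "single_valued G" by (auto simp: G_def single_valued_def)
  have G: "(x, y) \<in> G \<longleftrightarrow> x \<in> U \<and> y = f x" for x y by (auto simp: G_def)
  define R where "R x = {y. (x, y) \<in> G\<^sup>*}" for x
  have R_U: "R x \<subseteq> U" if "x \<in> U" for x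
  proof -
    have "y \<in> U" if "(x, y) \<in> G\<^sup>*" for y
      using that \<open>x \<in> U\<close> by induction (auto simp: G psubset.prems(2))
    then show ?thesis by (auto simp: R_def)
  qed
  obtain c where c: "c \<in> U" "\<And>x. x \<in> U \<Longrightarrow> card (R c) \<le> card (R x)"
    using psubset.prems(1) arg_min_if_finite[OF psubset.hyps(1) psubset.prems(1), of "\<lambda>x. card (R x)"]
    by (metis linorder_not_less)
  \<comment> \<open>Following an edge can only shrink the reachable set. By minimality of
    \<open>c\<close> it stays the same, so \<open>c\<close> is reachable from
    \<open>f c\<close>.\<close>
  have "R (f c) \<subseteq> R c"
    using c(1) by (auto simp: R_def G intro: converse_rtrancl_into_rtrancl)
  moreover have "finite (R c)"
    using R_U[OF c(1)] psubset.hyps(1) finite_subset by blast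
  ultimately have "R (f c) = R c"
    using c psubset.prems(2) by (metis card_seteq)
  then have cycle: "(f c, c) \<in> G\<^sup>*" by (auto simp: R_def)
  \<comment> \<open>\<open>C\<close> is the connected component of \<open>c\<close>: both
    \<open>C\<close> and its complement are closed under \<open>f\<close>.\<close>
  define C where "C = {x \<in> U. (x, c) \<in> G\<^sup>*}"
  have cC: "c \<in> C" "f c \<in> C" "C \<subseteq> U"
    using c(1) cycle psubset.prems(2) by (auto simp: C_def)
  have fC: "f x \<in> C" if "x \<in> C" for x
  proof (cases "x = c")
    case False
    moreover have "(x, c) \<in> G\<^sup>*" using that by (simp add: C_def)
    ultimately obtain z where "(x, z) \<in> G" "(z, c) \<in> G\<^sup>*" by (metis converse_rtranclE)
    then show ?thesis using psubset.prems(2) by (auto simp: C_def G)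
  qed (simp add: cC)
  \<comment> \<open>Without the edge from \<open>c\<close> the component is a tree rooted in
    \<open>c\<close>. The mark at \<open>f c\<close> remembers the missing edge, also when
    \<open>f c = c\<close>.\<close>
  have built_C: "built C ((\<lambda>x. (x, f x)) ` (C - {c})) c {f c}"
  proof (rule built_rooted)
    show "finite C" using cC(3) psubset.hyps(1) finite_subset by blast
    show "single_valued ((\<lambda>x. (x, f x)) ` (C - {c}))" by (auto simp: single_valued_def)
    fix x assume "x \<in> C"
    then have "(x, c) \<in> G\<^sup>*" by (simp add: C_def)
    then show "(x, c) \<in> ((\<lambda>x. (x, f x)) ` (C - {c}))\<^sup>*" using \<open>x \<in> C\<close>
    proof (induction rule: converse_rtrancl_induct)
      case (step y z)
      then have "z = f y" "z \<in> C" using fC by (auto simp: G)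
      then show ?case
        using step by (cases "y = c") (auto intro: converse_rtrancl_into_rtrancl)
    qed simp
  qed (use cC fC in auto)
  have C_eq: "(\<lambda>x. (x, f x)) ` (C - {c}) \<union> Pair c ` {f c} = (\<lambda>x. (x, f x)) ` C"
    using cC(1) by auto
  show ?case
  proof (cases "U = C")
    case True
    then show ?thesis using built_C C_eq by blast
  next
    case False
    have fD: "f x \<in> U - C" if "x \<in> U - C" for x
      using that psubset.prems(2) by (auto simp: C_def G intro: converse_rtrancl_into_rtrancl)
    obtain E r M where D: "built (U - C) E r M" "E \<union> Pair r ` M = (\<lambda>x. (x, f x)) ` (U - C)"
      using psubset.IH[of "U - C"] fD False cC by blast
    have "(U - C) \<union> C = U" "(U - C) \<inter> C = {}"
      using cC(3) by auto
    \<comment> \<open>The component \<open>C\<close> goes to the right of \<open>Adjoin\<close>,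
      which restores its missing edge. The root and marks left over are those of the rest, whose
      last missing edge is still pending.\<close>
    then have "built U (E \<union> (\<lambda>x. (x, f x)) ` (C - {c}) \<union> Pair c ` {f c}) r M"
      using adjoin[OF D(1) built_C] by simp
    moreover have "E \<union> (\<lambda>x. (x, f x)) ` (C - {c}) \<union> Pair c ` {f c} \<union> Pair r ` M = (\<lambda>x. (x, f x)) ` U"
    proof -
      have "U = (U - C) \<union> C" using cC(3) by blast
      then have "(\<lambda>x. (x, f x)) ` U = (\<lambda>x. (x, f x)) ` (U - C) \<union> (\<lambda>x. (x, f x)) ` C"
        by (metis image_Un)
      then show ?thesis unfolding D(2)[symmetric] C_eq[symmetric] by (simp only: Un_ac)
    qed
    ultimately show ?thesis by blast
  qed
qed

text \<open>The function of a model is decomposed by \<open>built_function\<close>, and each leaf is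
  labelled with the predicates true at its element. The vertex map is then an isomorphism.\<close>

lemma spectrum_tree:
  fixes \<phi> :: "'p mso"
  assumes "closed_mso \<phi>" "n \<in> spectrum V \<phi>"
  obtains t :: "('p set \<times> bool) tree" where "functional t" "models (struct_of t) \<phi>" "leaves t = n"
proof -
  obtain N :: "('p, nat) mstruct" where N: "is_struct V N" "finite (universe N)" "models N \<phi>"
    and n: "n = card (universe N)"
    using assms(2) by (auto simp: spectrum_def)
  have ne: "universe N \<noteq> {}" and f: "\<And>x. x \<in> universe N \<Longrightarrow> func N x \<in> universe N"
    using N(1) by (auto simp: is_struct_def)
  obtain E r M where built: "built (universe N) E r M"
    and E: "E \<union> Pair r ` M = (\<lambda>x. (x, func N x)) ` universe N"
    using built_function[OF N(2) ne, of "func N"] f by blast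
  obtain t :: "('p set \<times> bool) tree" and h where t: "bij_betw h (pos t) (universe N)"
    "map_prod h h ` edges t = E" "h (root t) = r" "h ` marks t = M"
    "\<forall>x\<in>pos t. fst (lab t x) = {p. h x \<in> prd N p}"
    using built_tree[OF built, of "\<lambda>a. {p. a \<in> prd N p}"] by blast
  have inj: "inj_on h (pos t)" and im: "h ` pos t = universe N"
    using t(1) by (auto simp: bij_betw_def)
  have "map_prod h h ` graph t = E \<union> Pair r ` M"
    unfolding graph_def image_Un t(2)[symmetric] t(3)[symmetric] t(4)[symmetric] by (simp add: image_image)
  then have img: "map_prod h h ` graph t = (\<lambda>x. (x, func N x)) ` universe N"
    using E by simp
  have graph: "(a, b) \<in> graph t \<longleftrightarrow> h b = func N (h a)" if ab: "a \<in> pos t" "b \<in> pos t" for a b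
  proof -
    have "(a, b) \<in> graph t \<longleftrightarrow> (h a, h b) \<in> map_prod h h ` graph t"
      using inj_on_image_mem_iff[OF map_prod_inj_on[OF inj inj], of "(a, b)" "graph t"]
        graph_subset_pos[of t] ab by simp
    also have "\<dots> \<longleftrightarrow> h b = func N (h a)"
      unfolding img using ab im by auto
    finally show ?thesis .
  qed
  have funct: "functional t"
    unfolding functional_def
  proof
    fix a assume a: "a \<in> pos t"
    then have "func N (h a) \<in> h ` pos t" using f im by blast
    then obtain b where b: "b \<in> pos t" "h b = func N (h a)" by auto
    have "(a, c) \<in> graph t \<longleftrightarrow> c = b" if "c \<in> pos t" for c
      using graph[OF a that] b inj_on_eq_iff[OF inj that b(1)] by simp
    with b(1) show "\<exists>b\<in>pos t. \<forall>c\<in>pos t. (a, c) \<in> graph t \<longleftrightarrow> c = b" by blast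
  qed
  have "leaves t = n"
    using bij_betw_same_card[OF t(1)] n card_pos[of t] by simp
  moreover have "models (struct_of t) \<phi>"
  proof -
    \<comment> \<open>As the formula is closed, a single valuation decides it; the constant root and
      empty sets are always admissible.\<close>
    have "sat (struct_of t) (\<lambda>_. root t) (\<lambda>_. {}) \<phi> \<longleftrightarrow> sat N (h \<circ> (\<lambda>_. root t)) (\<lambda>X. h ` {}) \<phi>"
    proof (rule sat_iso)
      show "func (struct_of t) a \<in> universe (struct_of t) \<and> h (func (struct_of t) a) = func N (h a)"
        if "a \<in> universe (struct_of t)" for a
        using func_struct_of[OF funct] graph[of a "func (struct_of t) a"] that by simp
    qed (use t root_in_pos[of t] in \<open>auto simp: struct_of_def\<close>)
    then show ?thesis
      using models_closed_iff[OF assms(1)] ne N(3) root_in_pos[of t] by (metis universe_struct_of empty_iff)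
  qed
  ultimately show thesis using that funct by blast
qed

theorem theorem1p1:
  fixes V :: "'p set" and \<phi> :: "'p mso"
  assumes "finite V"
    and "preds \<phi> \<subseteq> V"
    and "closed_mso \<phi>"
  shows "eventually_periodic (spectrum V \<phi>)"
proof -
  obtain \<theta> p :: nat where "0 < p"
    and pump: "\<And>t. \<theta> \<le> leaves t \<Longrightarrow> functional t \<Longrightarrow> models (struct_of t) \<phi> \<Longrightarrow>
      \<exists>t'. functional t' \<and> models (struct_of t') \<phi> \<and> leaves t' = leaves t + p"
    by (rule spectrum_pumping[OF assms(3)]) (rule that)
  have "n + p \<in> spectrum V \<phi>" if n: "\<theta> \<le> n" "n \<in> spectrum V \<phi>" for n
  proof -
    obtain t :: "('p set \<times> bool) tree" where "functional t" "models (struct_of t) \<phi>" "leaves t = n"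
      using spectrum_tree[OF assms(3) n(2)] by blast
    with pump[of t] n(1) obtain t' :: "('p set \<times> bool) tree"
      where t': "functional t'" "models (struct_of t') \<phi>" "leaves t' = n + p" by blast
    \<comment> \<open>The structure of the pumped tree lives on leaf addresses;
      \<open>card_in_spectrum\<close> moves it to natural numbers.\<close>
    then show ?thesis
      using card_in_spectrum[of V "struct_of t'" \<phi>] is_struct_struct_of[of t' V]
      by (simp add: finite_pos card_pos)
  qed
  with \<open>0 < p\<close> show ?thesis
    unfolding eventually_periodic_def by blast
qed

end
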